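(* Let $\alpha\in(0,1)$ be a quadratic irrational with primitive irreducible minimal polynomial $f(x)=ax^2+bx+c\in\mathbb{Z}[x]$ and height $H=\max\{|a|,|b|,|c|\}$. Let $N\ge 0$ be an integer, suppose that $\theta_N\in R$ and that the $L$-run following time $N$ has length $k\ge 1$ (that is, $\theta_{N+1},\ldots,\theta_{N+k}\in L$ and $\theta_{N+k+1}\notin L$). Put $$q_N=3^{N+1},\qquad p_N=3\lfloor 3^N\alpha\rfloor+2,\qquad A_N=q_N^2 f(p_N/q_N)=ap_N^2+bp_Nq_N+cq_N^2.$$ Then $$0<|A_N|\le 9H\,3^{N-k}.$$ In particular, if for some real number $T$ one has $k\ge N+\log_3 H+T$, then $$0<|A_N|\le 9\cdot 3^{-T};$$ equivalently, with $n=N+1$, the pair $(p_N,3^n)$ is coprime and $p=p_N$ satisfies one of the finitely many equations $$ap^2+bp\,3^n+c\,3^{2n}=u,\qquad u\in\mathbb{Z},\quad 0<|u|\le\left\lfloor 9\cdot 3^{-T}\right\rfloor.$$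
   Context: Let $L=[0,1/3)$ and $R=[2/3,1)$. For an irrational $\alpha\in(0,1)$ and an integer $n\ge 0$, $\theta_n=\{3^n\alpha\}$ is the fractional part of $3^n\alpha$. $\log_3$ is the logarithm to base $3$. *)

theory Defs
  imports Complex_Main "HOL-Computational_Algebra.Computational_Algebra"
begin

definition L_set :: "real set" where
  "L_set = {0..<1/3}"

definition R_set :: "real set" where
  "R_set = {2/3..<1}"

definition theta :: "real \<Rightarrow> nat \<Rightarrow> real" where
  "theta \<alpha> n = frac (3 ^ n * \<alpha>)"

definition L_run_after :: "real \<Rightarrow> nat \<Rightarrow> nat \<Rightarrow> bool" where
  "L_run_after \<alpha> N k \<longleftrightarrow>
     (\<forall>i\<in>{1..k}. theta \<alpha> (N + i) \<in> L_set) \<and> theta \<alpha> (N + k + 1) \<notin> L_set"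

text \<open>The sign of the leading coefficient of \<open>f\<close> is left free.
  Irreducibility of \<open>f\<close> in \<open>\<int>[x]\<close> together with primitivity and the root condition
  determines \<open>f\<close> up to sign.\<close>
definition primitive_minimal_poly :: "real \<Rightarrow> int poly \<Rightarrow> bool" where
  "primitive_minimal_poly \<alpha> f \<longleftrightarrow>
     content f = 1 \<and> irreducible f \<and> poly (map_poly of_int f) \<alpha> = 0"

definition q_seq :: "nat \<Rightarrow> int" where
  "q_seq N = 3 ^ (N + 1)"

definition p_seq :: "real \<Rightarrow> nat \<Rightarrow> int" where
  "p_seq \<alpha> N = 3 * \<lfloor>3 ^ N * \<alpha>\<rfloor> + 2"

definition A_seq :: "int poly \<Rightarrow> real \<Rightarrow> nat \<Rightarrow> real" where
  "A_seq f \<alpha> N =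
     (of_int (q_seq N))\<^sup>2 * poly (map_poly of_int f) (of_int (p_seq \<alpha> N) / of_int (q_seq N))"

end

theory Submission
  imports Defs
begin

text \<open>The number \<open>p_seq \<alpha> N / q_seq N\<close> is the ternary expansion of \<open>\<alpha>\<close> cut off after the digit
  at position \<open>N + 1\<close>, because \<open>\<theta>\<^sub>N \<in> R\<close> says that this digit is \<open>2\<close>. The remainder satisfies
  \<open>q\<^sub>N \<alpha> - p\<^sub>N = \<theta>\<^sub>N\<^sub>+\<^sub>1\<close> (\<open>q_mult_eq_p_plus_theta\<close>). Each step of the \<open>L\<close>-run multiplies
  \<open>\<theta>\<close> by exactly \<open>3\<close>, so staying below \<open>1/3\<close> for \<open>k\<close> steps forces
  \<open>\<theta>\<^sub>N\<^sub>+\<^sub>1 < 3\<^sup>-\<^sup>k\<close> (\<open>theta_start_of_L_run_less\<close>): the run of zero digits makes \<open>p\<^sub>N/q\<^sub>N\<close> an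
  unusually good rational approximation of \<open>\<alpha>\<close>.

  Now \<open>f(\<alpha>) = 0\<close>, so \<open>f(y) = (y - \<alpha>) (a (y + \<alpha>) + b)\<close>. At \<open>y = p\<^sub>N/q\<^sub>N\<close>, a point of \<open>[0,1]\<close>, the
  second factor is at most \<open>2H + H\<close> in absolute value, and multiplication by \<open>q\<^sub>N\<^sup>2\<close> gives
  \<open>\<bar>A\<^sub>N\<bar> \<le> q\<^sub>N \<theta>\<^sub>N\<^sub>+\<^sub>1 \<cdot> 3H \<le> 3\<^sup>N\<^sup>+\<^sup>1 \<cdot> 3\<^sup>-\<^sup>k \<cdot> 3H\<close>. The same factorisation shows \<open>A\<^sub>N \<noteq> 0\<close>: either
  factor vanishing at a rational \<open>y\<close> would make \<open>\<alpha>\<close> rational.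

  The equations restate the bound, since \<open>A\<^sub>N\<close> is an integer and
  \<open>p\<^sub>N\<close> is congruent to \<open>2\<close> modulo \<open>3\<close>.\<close>

lemma frac_triple_eq:
  fixes x :: real
  assumes "frac x < 1/3"
  shows "frac (3 * x) = 3 * frac x"
proof -
  have "3 * x = 3 * frac x + of_int (3 * \<lfloor>x\<rfloor>)"
    by (simp add: frac_def)
  moreover have "0 \<le> 3 * frac x" "3 * frac x < 1"
    using assms by auto
  ultimately show ?thesis
    by (simp add: frac_unique_iff)
qed

lemma triple_eq_of_frac_ge:
  fixes x :: real
  assumes "2/3 \<le> frac x"
  shows "3 * x = of_int (3 * \<lfloor>x\<rfloor> + 2) + frac (3 * x)"
proof -
  have "frac (3 * x) = 3 * frac x - 2"
    using assms frac_lt_1[of x] by (simp add: frac_unique_iff) (simp add: frac_def)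
  then show ?thesis
    by (simp add: frac_def)
qed

lemma q_mult_eq_p_plus_theta:
  assumes "theta \<alpha> N \<in> R_set"
  shows "of_int (q_seq N) * \<alpha> = of_int (p_seq \<alpha> N) + theta \<alpha> (N + 1)"
  using assms triple_eq_of_frac_ge[of "3 ^ N * \<alpha>"]
  by (simp add: theta_def R_set_def q_seq_def p_seq_def mult.assoc)

text \<open>Inside \<open>L\<close> the map \<open>x \<mapsto> 3x\<close> modulo \<open>1\<close> has no carry, so it is an exact dilation
  as long as the orbit stays there.\<close>
lemma theta_add_in_L_run:
  assumes "\<And>i. i < j \<Longrightarrow> theta \<alpha> (M + i) \<in> L_set"
  shows "theta \<alpha> (M + j) = 3 ^ j * theta \<alpha> M"
  using assms
proof (induction j)
  case (Suc j)
  have "theta \<alpha> (M + j) < 1/3"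
    using Suc.prems[of j] by (simp add: L_set_def)
  then have "theta \<alpha> (M + Suc j) = 3 * theta \<alpha> (M + j)"
    using frac_triple_eq[of "3 ^ (M + j) * \<alpha>"] by (simp add: theta_def mult.assoc)
  then show ?case
    using Suc by simp
qed simp

text \<open>A run of length \<open>k\<close> contains only \<open>k - 1\<close> dilation steps; the last factor \<open>3\<close> comes from the
  bound \<open>1/3\<close> on its final point.\<close>
lemma theta_start_of_L_run_less:
  assumes "L_run_after \<alpha> N k" "k \<ge> 1"
  shows "3 ^ k * theta \<alpha> (N + 1) < 1"
proof -
  obtain j where k: "k = Suc j"
    using assms(2) by (cases k) auto
  have L: "theta \<alpha> (N + i) \<in> L_set" if "1 \<le> i" "i \<le> k" for i
    using assms(1) that by (simp add: L_run_after_def)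
  have "theta \<alpha> (N + 1 + j) = 3 ^ j * theta \<alpha> (N + 1)"
  proof (rule theta_add_in_L_run)
    show "theta \<alpha> (N + 1 + i) \<in> L_set" if "i < j" for i
      using L[of "Suc i"] that k by simp
  qed
  moreover have "theta \<alpha> (N + 1 + j) < 1/3"
    using L[of k] k by (simp add: L_set_def)
  ultimately show ?thesis
    by (simp add: k)
qed

lemma quadratic_factor_at_root:
  fixes a b c x y :: "'a :: comm_ring_1"
  assumes "a * x\<^sup>2 + b * x + c = 0"
  shows "a * y\<^sup>2 + b * y + c = (y - x) * (a * (y + x) + b)"
proof -
  have "a * y\<^sup>2 + b * y + c = a * y\<^sup>2 + b * y + c - (a * x\<^sup>2 + b * x + c)"
    using assms by simp
  also have "\<dots> = (y - x) * (a * (y + x) + b)"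
    by (simp add: algebra_simps power2_eq_square)
  finally show ?thesis .
qed

text \<open>The linear cofactor \<open>a (y + x) + b\<close> would express \<open>x\<close> as \<open>- b/a - y\<close>, so in degree two one
  irrational root already excludes all rational roots.\<close>
lemma quadratic_nonzero_at_rational:
  fixes a b c :: int and x y :: real
  assumes root: "of_int a * x\<^sup>2 + of_int b * x + of_int c = 0"
    and "a \<noteq> 0" "x \<notin> \<rat>" "y \<in> \<rat>"
  shows "of_int a * y\<^sup>2 + of_int b * y + of_int c \<noteq> 0"
proof
  assume "of_int a * y\<^sup>2 + of_int b * y + of_int c = 0"
  moreover have "y \<noteq> x"
    using assms by auto
  ultimately have "of_int a * (y + x) + of_int b = 0"
    using quadratic_factor_at_root[OF root, of y] by simp
  then have "x = - of_int b / of_int a - y"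
    using \<open>a \<noteq> 0\<close> by (simp add: field_simps)
  then have "x \<in> \<rat>"
    using \<open>y \<in> \<rat>\<close> by simp
  then show False
    using \<open>x \<notin> \<rat>\<close> by simp
qed

lemma quadratic_le_dist_root:
  fixes a b c H x y :: real
  assumes root: "a * x\<^sup>2 + b * x + c = 0"
    and "\<bar>a\<bar> \<le> H" "\<bar>b\<bar> \<le> H" "\<bar>x\<bar> \<le> 1" "\<bar>y\<bar> \<le> 1"
  shows "\<bar>a * y\<^sup>2 + b * y + c\<bar> \<le> \<bar>y - x\<bar> * (3 * H)"
proof -
  have "\<bar>a * (y + x)\<bar> \<le> H * 2"
    unfolding abs_mult by (rule mult_mono) (use assms in auto)
  then have "\<bar>a * (y + x) + b\<bar> \<le> 3 * H"
    using assms(3) by linarith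
  then show ?thesis
    by (simp add: quadratic_factor_at_root[OF root] abs_mult mult_left_mono)
qed

lemma q_seq_pos: "q_seq N > 0"
  by (simp add: q_seq_def)

lemma A_seq_eq_quadratic:
  fixes \<alpha> :: real and N :: nat
  defines "y \<equiv> of_int (p_seq \<alpha> N) / of_int (q_seq N)"
  assumes "f = [:c, b, a:]"
  shows "A_seq f \<alpha> N = (of_int (q_seq N))\<^sup>2 * (of_int a * y\<^sup>2 + of_int b * y + of_int c)"
  by (simp add: A_seq_def assms map_poly_pCons algebra_simps power2_eq_square)

lemma A_seq_eq_binary_form:
  assumes "f = [:c, b, a:]"
  shows "A_seq f \<alpha> N = of_int (a * (p_seq \<alpha> N)\<^sup>2 + b * p_seq \<alpha> N * q_seq N + c * (q_seq N)\<^sup>2)"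
  using q_seq_pos[of N] by (simp add: A_seq_eq_quadratic[OF assms] field_simps power2_eq_square)

lemma abs_A_seq_le:
  assumes f: "f = [:c, b, a:]"
    and root: "of_int a * \<alpha>\<^sup>2 + of_int b * \<alpha> + of_int c = 0"
    and H: "\<bar>a\<bar> \<le> H" "\<bar>b\<bar> \<le> H"
    and \<alpha>: "0 < \<alpha>" "\<alpha> < 1"
    and R: "theta \<alpha> N \<in> R_set"
    and run: "L_run_after \<alpha> N k" "k \<ge> 1"
  shows "\<bar>A_seq f \<alpha> N\<bar> \<le> 9 * of_int H * 3 powi (int N - int k)"
proof -
  define p q t where "p = real_of_int (p_seq \<alpha> N)" and "q = real_of_int (q_seq N)"
    and "t = theta \<alpha> (N + 1)"
  have q: "q = 3 ^ (N + 1)" "q > 0"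
    by (simp_all add: q_def q_seq_def)
  have p: "q * \<alpha> = p + t"
    using q_mult_eq_p_plus_theta[OF R] by (simp add: p_def q_def t_def)
  have "t \<ge> 0"
    by (simp add: t_def theta_def)
  have "p \<ge> 0"
    using \<alpha> by (simp add: p_def p_seq_def)
  have "p \<le> q"
  proof -
    have "q * \<alpha> \<le> q"
      using \<alpha> q by simp
    then show ?thesis
      using p \<open>t \<ge> 0\<close> by linarith
  qed
  have dist: "\<bar>p / q - \<alpha>\<bar> = t / q"
  proof -
    have "p / q - \<alpha> = - (t / q)"
      using p q by (simp add: field_simps)
    then show ?thesis
      using q \<open>t \<ge> 0\<close> by simp
  qed
  have "A_seq f \<alpha> N = q\<^sup>2 * (of_int a * (p / q)\<^sup>2 + of_int b * (p / q) + of_int c)"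
    by (simp only: A_seq_eq_quadratic[OF f] p_def q_def)
  moreover have "\<bar>of_int a * (p / q)\<^sup>2 + of_int b * (p / q) + of_int c\<bar>
      \<le> \<bar>p / q - \<alpha>\<bar> * (3 * of_int H)"
    by (rule quadratic_le_dist_root[OF root])
       (use H \<alpha> q \<open>p \<ge> 0\<close> \<open>p \<le> q\<close> in \<open>auto simp flip: of_int_abs\<close>)
  ultimately have "\<bar>A_seq f \<alpha> N\<bar> \<le> q\<^sup>2 * (t / q * (3 * of_int H))"
    unfolding dist by (simp only: abs_mult abs_power2 mult_left_mono zero_le_power2)
  also have "\<dots> = q * t * (3 * of_int H)"
    using q by (simp add: power2_eq_square)
  also have "\<dots> \<le> q * (1 / 3 ^ k) * (3 * of_int H)"
  proof -
    have "t \<le> 1 / 3 ^ k"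
      using theta_start_of_L_run_less[OF run] by (simp add: t_def field_simps)
    then show ?thesis
      using q H by (intro mult_right_mono mult_left_mono) auto
  qed
  also have "\<dots> = 9 * of_int H * 3 powi (int N - int k)"
    by (simp add: q power_int_diff)
  finally show ?thesis .
qed

lemma p_seq_coprime_power_3: "coprime (p_seq \<alpha> N) (3 ^ n)"
proof -
  have "coprime (3 * \<lfloor>3 ^ N * \<alpha>\<rfloor> + 2) 3"
  proof (rule coprimeI)
    fix d assume d: "d dvd 3 * \<lfloor>3 ^ N * \<alpha>\<rfloor> + 2" "d dvd 3"
    then have "d dvd 2"
      using dvd_add_right_iff[of d "3 * \<lfloor>3 ^ N * \<alpha>\<rfloor>" 2] by (simp add: dvd_mult2)
    then show "d dvd 1"
      using dvd_diff[OF d(2), of 2] by simp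
  qed
  then show ?thesis
    by (simp add: p_seq_def)
qed

lemma height_bound_of_run_length:
  fixes H T :: real
  assumes "H > 0" "real k \<ge> real N + log 3 H + T"
  shows "9 * H * 3 powi (int N - int k) \<le> 9 * 3 powr (- T)"
proof -
  have "H * 3 powi (int N - int k) = 3 powr (log 3 H + (real N - real k))"
    using assms(1) by (simp add: powr_add flip: powr_real_of_int')
  also have "\<dots> \<le> 3 powr (- T)"
    using assms(2) by simp
  finally show ?thesis
    by simp
qed

theorem proposition5p1:
  fixes \<alpha> :: real and f :: "int poly" and a b c H :: int and N k :: nat
  assumes "0 < \<alpha>" and "\<alpha> < 1" and "\<alpha> \<notin> \<rat>"
    and "f = [:c, b, a:]" and "degree f = 2" and "primitive_minimal_poly \<alpha> f"
    and "H = Max {\<bar>a\<bar>, \<bar>b\<bar>, \<bar>c\<bar>}"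
    and "theta \<alpha> N \<in> R_set"
    and "k \<ge> 1" and "L_run_after \<alpha> N k"
  shows
    "A_seq f \<alpha> N = of_int (a * (p_seq \<alpha> N)\<^sup>2 + b * p_seq \<alpha> N * q_seq N + c * (q_seq N)\<^sup>2)
     \<and> 0 < \<bar>A_seq f \<alpha> N\<bar>
     \<and> \<bar>A_seq f \<alpha> N\<bar> \<le> 9 * of_int H * 3 powi (int N - int k)
     \<and> (\<forall>T :: real.
          (let bound = (0 < \<bar>A_seq f \<alpha> N\<bar> \<and> \<bar>A_seq f \<alpha> N\<bar> \<le> 9 * 3 powr (- T));
               n = N + 1;
               p = p_seq \<alpha> N;
               U = {u :: int. 0 < \<bar>u\<bar> \<and> \<bar>u\<bar> \<le> \<lfloor>9 * 3 powr (- T)\<rfloor>};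
               equations = (coprime p (3 ^ n) \<and> finite U \<and>
                 (\<exists>u\<in>U. a * p\<^sup>2 + b * p * 3 ^ n + c * 3 ^ (2 * n) = u))
           in (bound \<longleftrightarrow> equations)
              \<and> (real k \<ge> real N + log 3 (of_int H) + T \<longrightarrow> bound \<and> equations)))"
proof -
  define A :: int where
    "A = a * (p_seq \<alpha> N)\<^sup>2 + b * p_seq \<alpha> N * q_seq N + c * (q_seq N)\<^sup>2"
  have A: "A_seq f \<alpha> N = of_int A"
    using A_seq_eq_binary_form[OF assms(4)] by (simp only: A_def)
  have "a \<noteq> 0"
    using assms(4,5) by (auto split: if_splits)
  have root: "of_int a * \<alpha>\<^sup>2 + of_int b * \<alpha> + of_int c = 0"
    using assms(4,6)
    by (simp add: primitive_minimal_poly_def map_poly_pCons algebra_simps power2_eq_square)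
  have H: "\<bar>a\<bar> \<le> H" "\<bar>b\<bar> \<le> H"
    unfolding assms(7) by (rule Max_ge; simp)+
  have pos: "0 < \<bar>A_seq f \<alpha> N\<bar>"
  proof -
    have "of_int (p_seq \<alpha> N) / of_int (q_seq N) \<in> (\<rat> :: real set)"
      by simp
    from quadratic_nonzero_at_rational[OF root \<open>a \<noteq> 0\<close> assms(3) this]
    have "A_seq f \<alpha> N \<noteq> 0"
      unfolding A_seq_eq_quadratic[OF assms(4)] using q_seq_pos[of N] by simp
    then show ?thesis by simp
  qed
  have le: "\<bar>A_seq f \<alpha> N\<bar> \<le> 9 * of_int H * 3 powi (int N - int k)"
    by (rule abs_A_seq_le[OF assms(4) root H assms(1,2,8,10,9)])
  have form: "a * (p_seq \<alpha> N)\<^sup>2 + b * p_seq \<alpha> N * 3 ^ (N + 1) + c * 3 ^ (2 * (N + 1)) = A"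
    by (simp add: A_def q_seq_def power_mult_distrib flip: power_mult)
  have finite_U: "finite {u :: int. 0 < \<bar>u\<bar> \<and> \<bar>u\<bar> \<le> B}" for B
    by (rule finite_subset[of _ "{-B..B}"]) auto
  have floor_iff: "\<bar>A_seq f \<alpha> N\<bar> \<le> B \<longleftrightarrow> \<bar>A\<bar> \<le> \<lfloor>B\<rfloor>" for B
    by (simp add: A le_floor_iff)
  have run_bound: "\<bar>A_seq f \<alpha> N\<bar> \<le> 9 * 3 powr (- T)"
    if "real k \<ge> real N + log 3 (of_int H) + T" for T
  proof -
    have "real_of_int H > 0"
      using H \<open>a \<noteq> 0\<close> by simp
    from le height_bound_of_run_length[OF this that] show ?thesis
      by linarith
  qed
  have A_pos: "0 < \<bar>A\<bar>"
    using pos A by simp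
  have bound_iff: "(0 < \<bar>A_seq f \<alpha> N\<bar> \<and> \<bar>A_seq f \<alpha> N\<bar> \<le> B) \<longleftrightarrow>
      coprime (p_seq \<alpha> N) (3 ^ (N + 1)) \<and> finite {u :: int. 0 < \<bar>u\<bar> \<and> \<bar>u\<bar> \<le> \<lfloor>B\<rfloor>} \<and>
      (\<exists>u\<in>{u. 0 < \<bar>u\<bar> \<and> \<bar>u\<bar> \<le> \<lfloor>B\<rfloor>}.
        a * (p_seq \<alpha> N)\<^sup>2 + b * p_seq \<alpha> N * 3 ^ (N + 1) + c * 3 ^ (2 * (N + 1)) = u)" for B
    unfolding form using pos A_pos floor_iff[of B] finite_U[of "\<lfloor>B\<rfloor>"] p_seq_coprime_power_3
    by blast
  show ?thesis
    unfolding Let_def bound_iff[symmetric]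
    using A pos le run_bound unfolding A_def by blast
qed

end
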